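(* Let $W$ be a finite-dimensional real inner product space and let $A\in \mathrm{End}(W)$ be symmetric. Consider the initial value problem $$\frac{dX}{dt}=X\,X,\qquad X(0)=A,$$ for an unknown $X=X(t)\in \mathrm{End}(W)$. Then for every $t$ in the maximal interval of existence of the solution, $\mathrm{Id}-tA$ is invertible and $$X(t)=A\,(\mathrm{Id}-tA)^{-1},$$ and the solution blows up at a finite time if and only if the spectrum of $A$ contains a non-zero real number.
   Context: $\mathrm{End}(W)$ is the algebra of linear operators on $W$, $\mathrm{Id}$ is the identity operator, and products are compositions of operators. A solution is a differentiable $\mathrm{End}(W)$-valued function on an open interval containing $0$. Let $(T_-,T_+)$, with $-\infty\le T_-<0<T_+\le\infty$, be the maximal interval of existence of the solution with $X(0)=A$. The solution "blows up at a finite time" if $T_->-\infty$ or $T_+<\infty$ (both forward and backward time are allowed). *)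

theory Defs
  imports "HOL-Analysis.Analysis"
begin

text \<open>
  For finite-dimensional \<open>W\<close> every linear operator is bounded, so \<open>End(W)\<close> is rendered by the type
  \<^typ>\<open>'a \<Rightarrow>\<^sub>L 'a\<close>, with its operator norm and with \<^term>\<open>(o\<^sub>L)\<close> as product.  Working over
  \<^class>\<open>real_inner\<close> with an explicit finiteness assumption, instead of over
  \<^class>\<open>euclidean_space\<close>, does not exclude the zero space.
\<close>

definition finite_dimensional :: "'a::real_vector itself \<Rightarrow> bool" where
  "finite_dimensional _ \<longleftrightarrow> (\<exists>B :: 'a set. finite B \<and> span B = UNIV)"

definition symmetric_op :: "('a::real_inner \<Rightarrow>\<^sub>L 'a) \<Rightarrow> bool" where
  "symmetric_op A \<longleftrightarrow> (\<forall>x y. inner (blinfun_apply A x) y = inner x (blinfun_apply A y))"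

definition is_inverse_op ::
  "('a::real_normed_vector \<Rightarrow>\<^sub>L 'a) \<Rightarrow> ('a \<Rightarrow>\<^sub>L 'a) \<Rightarrow> bool" where
  "is_inverse_op A B \<longleftrightarrow> A o\<^sub>L B = id_blinfun \<and> B o\<^sub>L A = id_blinfun"

definition invertible_op :: "('a::real_normed_vector \<Rightarrow>\<^sub>L 'a) \<Rightarrow> bool" where
  "invertible_op A \<longleftrightarrow> (\<exists>B. is_inverse_op A B)"

text \<open>Meaningful only if \<open>A\<close> is invertible; two-sided inverses are unique.\<close>

definition inverse_op :: "('a::real_normed_vector \<Rightarrow>\<^sub>L 'a) \<Rightarrow> ('a \<Rightarrow>\<^sub>L 'a)" where
  "inverse_op A = (THE B. is_inverse_op A B)"

text \<open>The real points of the spectrum; a symmetric operator has no others.\<close>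

definition spectrum_op :: "('a::real_normed_vector \<Rightarrow>\<^sub>L 'a) \<Rightarrow> real set" where
  "spectrum_op A = {l. \<not> invertible_op (A - l *\<^sub>R id_blinfun)}"

text \<open>
  A solution of the initial value problem on the open interval \<open>(a, b)\<close>, whose end points may be
  infinite.  Values of \<open>X\<close> outside \<open>(a, b)\<close> are irrelevant.
\<close>

definition ivp_solution ::
  "('a::real_normed_vector \<Rightarrow>\<^sub>L 'a) \<Rightarrow> ereal \<Rightarrow> ereal \<Rightarrow> (real \<Rightarrow> ('a \<Rightarrow>\<^sub>L 'a)) \<Rightarrow> bool" where
  "ivp_solution A a b X \<longleftrightarrow> a < 0 \<and> 0 < b \<and> X 0 = A \<and>
     (\<forall>t\<in>einterval a b. (X has_vector_derivative (X t o\<^sub>L X t)) (at t))"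

text \<open>
  A solution that cannot be extended to a larger open interval; \<open>(a, b)\<close> is then the maximal
  interval of existence.
\<close>

definition maximal_ivp_solution ::
  "('a::real_normed_vector \<Rightarrow>\<^sub>L 'a) \<Rightarrow> ereal \<Rightarrow> ereal \<Rightarrow> (real \<Rightarrow> ('a \<Rightarrow>\<^sub>L 'a)) \<Rightarrow> bool" where
  "maximal_ivp_solution A a b X \<longleftrightarrow> ivp_solution A a b X \<and>
     (\<forall>a' b' Y. ivp_solution A a' b' Y \<and> a' \<le> a \<and> b \<le> b' \<and> (\<forall>t\<in>einterval a b. Y t = X t)
        \<longrightarrow> a' = a \<and> b' = b)"

definition blows_up_at_finite_time :: "ereal \<Rightarrow> ereal \<Rightarrow> bool" where
  "blows_up_at_finite_time a b \<longleftrightarrow> - \<infinity> < a \<or> b < \<infinity>"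

end

theory Submission
  imports Defs
begin

text \<open>
  Write \<open>R(t) = A (Id - tA)\<^sup>-\<^sup>1\<close> on the set \<open>\<Omega>\<close> of times at which \<open>Id - tA\<close> is invertible.

  If \<open>X\<close> is a solution, then \<open>P = X (Id - tA) - A\<close> satisfies the linear equation \<open>P' = X P\<close> with
  \<open>P(0) = 0\<close>, so \<open>P\<close> vanishes (lemma \<open>zero_if_derivative_bounded\<close>, a form of Gronwall's inequality).
  Hence \<open>X (Id - tA) = A\<close>.  A vector in the kernel of \<open>Id - tA\<close> is then killed by \<open>A\<close> and hence
  zero.  In finite dimension an injective operator is invertible, so a solution lives inside \<open>\<Omega>\<close>
  and equals \<open>R\<close> (lemma \<open>ivp_solution_eq_resolvent\<close>).

  Conversely, \<open>\<Omega>\<close> is open, and the resolvent identity \<open>R(t) - R(s) = (t - s) R(t) R(s)\<close> shows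
  that \<open>R\<close> is a solution on every interval around \<open>0\<close> inside \<open>\<Omega>\<close>
  (lemma \<open>resolvent_ivp_solution\<close>).

  The maximal interval is therefore the connected component of \<open>0\<close> in \<open>\<Omega>\<close>.  It is the whole line
  exactly if \<open>\<Omega>\<close> is, that is, if no \<open>t\<close> makes \<open>Id - tA = -t (A - (1/t) Id)\<close> singular; the
  reciprocals \<open>1/t\<close> of the singular times are the non-zero real points of the spectrum.
\<close>

section \<open>Inverses of operators\<close>

lemma blinfun_eq_iff: "f = g \<longleftrightarrow> (\<forall>x. blinfun_apply f x = blinfun_apply g x)"
  by (auto intro: blinfun_eqI)

lemma is_inverse_op_iff:
  "is_inverse_op C B \<longleftrightarrow> (\<forall>x. C (B x) = x) \<and> (\<forall>x. B (C x) = x)"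
  unfolding is_inverse_op_def blinfun_eq_iff by simp

lemma is_inverse_op_unique:
  assumes "is_inverse_op C B" "is_inverse_op C B'"
  shows "B = B'"
  using assms unfolding is_inverse_op_iff by (metis blinfun_eqI)

lemma inverse_op_eq:
  assumes "is_inverse_op C B"
  shows "inverse_op C = B"
  unfolding inverse_op_def using assms is_inverse_op_unique by (intro the_equality) auto

lemma is_inverse_op_inverse_op:
  assumes "invertible_op C"
  shows "is_inverse_op C (inverse_op C)"
  using assms inverse_op_eq unfolding invertible_op_def by metis

lemma invertible_op_compose:
  assumes "invertible_op C" "invertible_op D"
  shows "invertible_op (C o\<^sub>L D)"
proof -
  obtain C' D' where "is_inverse_op C C'" "is_inverse_op D D'"
    using assms unfolding invertible_op_def by blast
  then have "is_inverse_op (C o\<^sub>L D) (D' o\<^sub>L C')"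
    by (simp add: is_inverse_op_iff)
  then show ?thesis
    unfolding invertible_op_def by blast
qed

lemma invertible_op_scaleR:
  assumes "invertible_op C" "r \<noteq> 0"
  shows "invertible_op (r *\<^sub>R C)"
proof -
  obtain B where "is_inverse_op C B"
    using assms unfolding invertible_op_def by blast
  then have "is_inverse_op (r *\<^sub>R C) (inverse r *\<^sub>R B)"
    using assms(2) by (simp add: is_inverse_op_iff blinfun.bilinear_simps)
  then show ?thesis
    unfolding invertible_op_def by blast
qed

lemma ex_nonzero_spectrum_iff:
  fixes A :: "'a::real_normed_vector \<Rightarrow>\<^sub>L 'a"
  shows "(\<exists>l\<in>spectrum_op A. l \<noteq> 0) \<longleftrightarrow> (\<exists>t. \<not> invertible_op (id_blinfun - t *\<^sub>R A))"
proof
  assume "\<exists>l\<in>spectrum_op A. l \<noteq> 0"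
  then obtain l where l: "l \<noteq> 0" "\<not> invertible_op (A - l *\<^sub>R id_blinfun)"
    unfolding spectrum_op_def by blast
  have "A - l *\<^sub>R id_blinfun = (- l) *\<^sub>R (id_blinfun - (1/l) *\<^sub>R A)"
    using l(1) by (simp add: algebra_simps)
  then show "\<exists>t. \<not> invertible_op (id_blinfun - t *\<^sub>R A)"
    using l invertible_op_scaleR by (metis neg_equal_0_iff_equal)
next
  assume "\<exists>t. \<not> invertible_op (id_blinfun - t *\<^sub>R A)"
  then obtain t where t: "\<not> invertible_op (id_blinfun - t *\<^sub>R A)"
    by blast
  have "is_inverse_op (id_blinfun :: 'a \<Rightarrow>\<^sub>L 'a) id_blinfun"
    by (simp add: is_inverse_op_iff)
  with t have "t \<noteq> 0"
    by (auto simp: invertible_op_def)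
  have "id_blinfun - t *\<^sub>R A = (- t) *\<^sub>R (A - (1/t) *\<^sub>R id_blinfun)"
    using \<open>t \<noteq> 0\<close> by (simp add: algebra_simps)
  then have "\<not> invertible_op (A - (1/t) *\<^sub>R id_blinfun)"
    using t \<open>t \<noteq> 0\<close> invertible_op_scaleR by (metis neg_equal_0_iff_equal)
  then show "\<exists>l\<in>spectrum_op A. l \<noteq> 0"
    using \<open>t \<noteq> 0\<close> unfolding spectrum_op_def by (intro bexI[of _ "1/t"]) auto
qed

section \<open>Finite dimension\<close>

lemma finite_dimensional_orthogonal_basis:
  assumes "finite_dimensional TYPE('a::real_inner)"
  obtains B :: "'a::real_inner set" where "finite B" "span B = UNIV" "independent B" "pairwise orthogonal B"
proof -
  obtain B0 :: "'a set" where "finite B0" "span B0 = UNIV"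
    using assms unfolding finite_dimensional_def by blast
  then obtain C :: "'a set" where C: "finite C" "span C = UNIV" "pairwise orthogonal C"
    using basis_orthogonal by metis
  show ?thesis
  proof
    show "pairwise orthogonal (C - {0})"
      using C(3) by (rule pairwise_mono) auto
    then show "independent (C - {0})"
      by (rule pairwise_orthogonal_independent) simp
  qed (use C in \<open>auto simp: span_delete_0\<close>)
qed

text \<open>
  The coordinates of a vector in an orthogonal basis are inner products, hence bounded by its norm.
\<close>

lemma linear_imp_bounded_linear_finite_dimensional:
  fixes g :: "'a::real_inner \<Rightarrow> 'b::real_normed_vector"
  assumes "finite_dimensional TYPE('a)" and g: "linear g"
  shows "bounded_linear g"
proof -
  obtain B :: "'a set" where B: "finite B" "span B = UNIV" "pairwise orthogonal B"
    using finite_dimensional_orthogonal_basis[OF assms(1)] by metis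
  have expand: "x = (\<Sum>b\<in>B. (b \<bullet> x / (b \<bullet> b)) *\<^sub>R b)" for x
  proof -
    define y where "y = x - (\<Sum>b\<in>B. (b \<bullet> x / (b \<bullet> b)) *\<^sub>R b)"
    have "orthogonal y c" if "c \<in> B" for c
    proof -
      have "c \<bullet> (\<Sum>b\<in>B. (b \<bullet> x / (b \<bullet> b)) *\<^sub>R b) = (\<Sum>b\<in>B. (b \<bullet> x / (b \<bullet> b)) * (c \<bullet> b))"
        by (simp add: inner_sum_right)
      also have "\<dots> = (\<Sum>b\<in>B. if b = c then c \<bullet> x else 0)"
        using B(3) that by (intro sum.cong) (auto simp: pairwise_def orthogonal_def)
      also have "\<dots> = c \<bullet> x"
        using B(1) that by simp
      finally show ?thesis
        by (simp add: y_def orthogonal_def inner_diff_right inner_commute[of _ c])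
    qed
    moreover have "y \<in> span B"
      using B(2) by simp
    ultimately have "orthogonal y y"
      by (metis orthogonal_to_span)
    then show ?thesis
      by (simp add: orthogonal_self y_def)
  qed
  have "norm (g x) \<le> norm x * (\<Sum>b\<in>B. norm b / (b \<bullet> b) * norm (g b))" for x
  proof -
    have "g x = (\<Sum>b\<in>B. (b \<bullet> x / (b \<bullet> b)) *\<^sub>R g b)"
      by (subst expand[of x]) (simp add: linear_sum[OF g] linear_cmul[OF g])
    also have "norm \<dots> \<le> (\<Sum>b\<in>B. norm x * (norm b / (b \<bullet> b) * norm (g b)))"
    proof (rule sum_norm_le)
      fix b
      have "\<bar>b \<bullet> x\<bar> / (b \<bullet> b) * norm (g b) \<le> (norm b * norm x) / (b \<bullet> b) * norm (g b)"
        by (intro mult_right_mono divide_right_mono Cauchy_Schwarz_ineq2) auto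
      then show "norm ((b \<bullet> x / (b \<bullet> b)) *\<^sub>R g b) \<le> norm x * (norm b / (b \<bullet> b) * norm (g b))"
        by (simp add: abs_divide mult_ac)
    qed
    finally show ?thesis
      by (simp add: sum_distrib_left)
  qed
  then show ?thesis
    using g by (intro bounded_linear_intro) (auto simp: linear_add linear_cmul)
qed

lemma invertible_op_if_injective:
  fixes C :: "'a::real_inner \<Rightarrow>\<^sub>L 'a"
  assumes "finite_dimensional TYPE('a)" and "\<And>x. C x = 0 \<Longrightarrow> x = 0"
  shows "invertible_op C"
proof -
  obtain B :: "'a set" where B: "finite B" "span B = UNIV" "independent B"
    using finite_dimensional_orthogonal_basis[OF assms(1)] by metis
  interpret finite_dimensional_vector_space scaleR B
    by unfold_locales (use B in \<open>auto simp: dependent_raw_def span_raw_def\<close>)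
  have lin: "linear (blinfun_apply C)"
    by (simp add: blinfun.bounded_linear_right bounded_linear.linear)
  have inj: "inj (blinfun_apply C)"
    using assms(2) linear_injective_0[OF lin] by blast
  then have "surj (blinfun_apply C)"
    using lin linear_inj_imp_surj by (simp add: linear_def)
  define g where "g = inv (blinfun_apply C)"
  have Cg: "C (g x) = x" and gC: "g (C x) = x" for x
    using \<open>surj (blinfun_apply C)\<close> inj by (simp_all add: g_def surj_f_inv_f)
  have "linear g"
    using gC Cg by (intro linearI) (metis blinfun.add_right, metis blinfun.scaleR_right)
  then have "bounded_linear g"
    using assms(1) by (rule linear_imp_bounded_linear_finite_dimensional[rotated])
  then have "is_inverse_op C (Blinfun g)"
    using Cg gC by (simp add: is_inverse_op_iff bounded_linear_Blinfun_apply)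
  then show ?thesis
    unfolding invertible_op_def by blast
qed

text \<open>
  As injectivity is enough in finite dimension, the estimate \<open>\<parallel>E x\<parallel> \<le> \<parallel>E\<parallel> \<parallel>x\<parallel>\<close> does the work of
  the Neumann series.
\<close>

lemma invertible_op_id_minus_small:
  fixes E :: "'a::real_inner \<Rightarrow>\<^sub>L 'a"
  assumes "finite_dimensional TYPE('a)" and "norm E < 1"
  shows "invertible_op (id_blinfun - E)"
proof (rule invertible_op_if_injective[OF assms(1)])
  fix x assume "(id_blinfun - E) x = 0"
  then have "x = E x"
    by (simp add: blinfun.bilinear_simps)
  then have "norm x \<le> norm E * norm x"
    by (metis norm_blinfun)
  then have "(1 - norm E) * norm x \<le> 0"
    by (simp add: algebra_simps)
  then show "x = 0"
    using assms(2) by (simp add: mult_le_0_iff)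
qed

section \<open>The function A (Id - tA)^(-1) as a solution\<close>

text \<open>
  Openness: around a regular time \<open>s\<close>, with \<open>V\<close> the inverse of \<open>Id - sA\<close>, one has
  \<open>Id - tA = (Id - sA) (Id - (t - s) V A)\<close>, and the second factor is close to the identity.
\<close>

lemma open_regular_times:
  fixes A :: "'a::real_inner \<Rightarrow>\<^sub>L 'a"
  assumes "finite_dimensional TYPE('a)"
  shows "open {t. invertible_op (id_blinfun - t *\<^sub>R A)}"
proof (rule openI)
  fix s assume "s \<in> {t. invertible_op (id_blinfun - t *\<^sub>R A)}"
  then have s: "invertible_op (id_blinfun - s *\<^sub>R A)"
    by simp
  then obtain V where V: "is_inverse_op (id_blinfun - s *\<^sub>R A) V"
    unfolding invertible_op_def by blast
  define e where "e = 1 / (norm (V o\<^sub>L A) + 1)"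
  have "0 < e"
    by (simp add: e_def add_nonneg_pos)
  moreover have "invertible_op (id_blinfun - t *\<^sub>R A)" if "t \<in> ball s e" for t
  proof -
    have "\<bar>t - s\<bar> < e"
      using that by (simp add: dist_real_def abs_minus_commute)
    then have "\<bar>t - s\<bar> * (norm (V o\<^sub>L A) + 1) < 1"
      by (simp add: e_def pos_less_divide_eq add_nonneg_pos)
    then have "\<bar>t - s\<bar> + \<bar>t - s\<bar> * norm (V o\<^sub>L A) < 1"
      by (simp add: algebra_simps)
    then have "norm ((t - s) *\<^sub>R (V o\<^sub>L A)) < 1"
      by (smt (verit) norm_scaleR)
    then have "invertible_op (id_blinfun - (t - s) *\<^sub>R (V o\<^sub>L A))"
      using assms by (rule invertible_op_id_minus_small[rotated])
    moreover have "id_blinfun - t *\<^sub>R A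
        = (id_blinfun - s *\<^sub>R A) o\<^sub>L (id_blinfun - (t - s) *\<^sub>R (V o\<^sub>L A))"
    proof (rule blinfun_eqI)
      fix x
      have "((id_blinfun - s *\<^sub>R A) o\<^sub>L (id_blinfun - (t - s) *\<^sub>R (V o\<^sub>L A))) x
          = (id_blinfun - s *\<^sub>R A) x - (t - s) *\<^sub>R (id_blinfun - s *\<^sub>R A) (V (A x))"
        by (simp add: blinfun.diff_right blinfun.scaleR_right blinfun.diff_left blinfun.scaleR_left)
      also have "\<dots> = (id_blinfun - t *\<^sub>R A) x"
        using V by (simp add: is_inverse_op_iff)
          (simp add: blinfun.bilinear_simps algebra_simps)
      finally show "(id_blinfun - t *\<^sub>R A) x
          = ((id_blinfun - s *\<^sub>R A) o\<^sub>L (id_blinfun - (t - s) *\<^sub>R (V o\<^sub>L A))) x" ..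
    qed
    ultimately show ?thesis
      using s invertible_op_compose by metis
  qed
  ultimately show "\<exists>e>0. ball s e \<subseteq> {t. invertible_op (id_blinfun - t *\<^sub>R A)}"
    by blast
qed

text \<open>
  The resolvent in Fredholm's form.  With the factor \<open>A\<close> included, its difference quotients are
  products of two of its own values.
\<close>

definition resolvent :: "('a::real_normed_vector \<Rightarrow>\<^sub>L 'a) \<Rightarrow> real \<Rightarrow> ('a \<Rightarrow>\<^sub>L 'a)" where
  "resolvent A t = A o\<^sub>L inverse_op (id_blinfun - t *\<^sub>R A)"

text \<open>
  The algebraic source of \<open>X' = X X\<close>: for the inverses \<open>V\<close> of \<open>Id - tA\<close> and \<open>W\<close> of \<open>Id - sA\<close>,
  \<open>V - W = V ((Id - sA) - (Id - tA)) W = (t - s) V A W\<close>.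
\<close>

lemma resolvent_identity:
  assumes "invertible_op (id_blinfun - t *\<^sub>R A)" "invertible_op (id_blinfun - s *\<^sub>R A)"
  shows "resolvent A t - resolvent A s = (t - s) *\<^sub>R (resolvent A t o\<^sub>L resolvent A s)"
proof (rule blinfun_eqI)
  fix x
  define V where "V = inverse_op (id_blinfun - t *\<^sub>R A)"
  define W where "W = inverse_op (id_blinfun - s *\<^sub>R A)"
  have V: "V ((id_blinfun - t *\<^sub>R A) y) = y" and W: "(id_blinfun - s *\<^sub>R A) (W y) = y" for y
    using assms[THEN is_inverse_op_inverse_op] by (simp_all add: V_def W_def is_inverse_op_iff)
  have "V x - W x = V ((id_blinfun - s *\<^sub>R A) (W x)) - V ((id_blinfun - t *\<^sub>R A) (W x))"
    by (simp add: V W)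
  also have "\<dots> = (t - s) *\<^sub>R V (A (W x))"
    by (simp add: blinfun.bilinear_simps algebra_simps)
  finally have "A (V x) - A (W x) = (t - s) *\<^sub>R A (V (A (W x)))"
    by (metis blinfun.diff_right blinfun.scaleR_right)
  then show "(resolvent A t - resolvent A s) x
      = ((t - s) *\<^sub>R (resolvent A t o\<^sub>L resolvent A s)) x"
    by (simp add: resolvent_def V_def W_def blinfun.bilinear_simps)
qed

lemma resolvent_has_vector_derivative:
  fixes A :: "'a::real_inner \<Rightarrow>\<^sub>L 'a"
  assumes "finite_dimensional TYPE('a)" and s: "invertible_op (id_blinfun - s *\<^sub>R A)"
  shows "(resolvent A has_vector_derivative (resolvent A s o\<^sub>L resolvent A s)) (at s)"
proof -
  let ?R = "resolvent A"
  define c where "c = norm (?R s)"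
  have ev_inv: "\<forall>\<^sub>F t in at s. invertible_op (id_blinfun - t *\<^sub>R A)"
    using open_regular_times[OF assms(1)] s eventually_at_in_open'[of _ s] by fastforce
  have id: "\<forall>\<^sub>F t in at s. ?R t - ?R s = (t - s) *\<^sub>R (?R t o\<^sub>L ?R s)"
    using ev_inv by eventually_elim (simp add: resolvent_identity[OF _ s])
  \<comment> \<open>Where \<open>|t - s| c \<le> 1/2\<close>, the resolvent identity absorbs half of \<open>\<parallel>R t\<parallel>\<close>.\<close>
  have "((\<lambda>t. \<bar>t - s\<bar> * c) \<longlongrightarrow> \<bar>s - s\<bar> * c) (at s)"
    by (intro tendsto_intros)
  then have "\<forall>\<^sub>F t in at s. \<bar>t - s\<bar> * c < 1/2"
    by (rule order_tendstoD) simp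
  with id have bound: "\<forall>\<^sub>F t in at s. norm (?R t - ?R s) \<le> \<bar>t - s\<bar> * (2 * c * c)"
  proof eventually_elim
    case (elim t)
    have prod: "norm (?R t - ?R s) \<le> \<bar>t - s\<bar> * (norm (?R t) * c)"
      unfolding elim(1) c_def by (simp add: mult_left_mono norm_blinfun_compose)
    also have "\<dots> \<le> (1/2) * norm (?R t)"
      using mult_right_mono[of "\<bar>t - s\<bar> * c" "1/2" "norm (?R t)"] elim(2) by (simp add: mult_ac)
    finally have "norm (?R t) \<le> 2 * c"
      using norm_triangle_ineq2[of "?R t" "?R s"] by (simp add: c_def)
    then have "\<bar>t - s\<bar> * (norm (?R t) * c) \<le> \<bar>t - s\<bar> * (2 * c * c)"
      by (intro mult_left_mono mult_right_mono) (auto simp: c_def)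
    with prod show ?case
      by simp
  qed
  have "((\<lambda>t. \<bar>t - s\<bar> * (2 * c * c)) \<longlongrightarrow> \<bar>s - s\<bar> * (2 * c * c)) (at s)"
    by (intro tendsto_intros)
  then have "((\<lambda>t. ?R t - ?R s) \<longlongrightarrow> 0) (at s)"
    using Lim_null_comparison[OF bound] by simp
  then have "(?R \<longlongrightarrow> ?R s) (at s)"
    by (simp add: LIM_zero_iff)
  then have "((\<lambda>t. ?R t o\<^sub>L ?R s) \<longlongrightarrow> ?R s o\<^sub>L ?R s) (at s)"
    by (intro bounded_bilinear.tendsto[OF bounded_bilinear_blinfun_compose] tendsto_const)
  then have "((\<lambda>t. norm ((?R t o\<^sub>L ?R s) - (?R s o\<^sub>L ?R s))) \<longlongrightarrow> 0) (at s)"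
    by (intro tendsto_norm_zero) (simp add: LIM_zero_iff)
  moreover have "\<forall>\<^sub>F t in at s. t \<noteq> s"
    by (simp add: eventually_at_filter)
  with id have "\<forall>\<^sub>F t in at s. norm ((?R t o\<^sub>L ?R s) - (?R s o\<^sub>L ?R s))
      = norm (?R t - ?R s - (t - s) *\<^sub>R (?R s o\<^sub>L ?R s)) / norm (t - s)"
  proof eventually_elim
    case (elim t)
    have "?R t - ?R s - (t - s) *\<^sub>R (?R s o\<^sub>L ?R s)
        = (t - s) *\<^sub>R ((?R t o\<^sub>L ?R s) - (?R s o\<^sub>L ?R s))"
      by (simp add: elim(1) scaleR_diff_right)
    then show ?case
      using elim(2) by simp
  qed
  ultimately have "((\<lambda>t. norm (?R t - ?R s - (t - s) *\<^sub>R (?R s o\<^sub>L ?R s)) / norm (t - s)) \<longlongrightarrow> 0) (at s)"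
    by (rule Lim_transform_eventually)
  then show ?thesis
    by (simp add: has_vector_derivative_def has_derivative_iff_norm bounded_linear_scaleR_left)
qed

lemma resolvent_ivp_solution:
  fixes A :: "'a::real_inner \<Rightarrow>\<^sub>L 'a"
  assumes "finite_dimensional TYPE('a)" and "a < 0" "0 < b"
    and "\<And>t. t \<in> einterval a b \<Longrightarrow> invertible_op (id_blinfun - t *\<^sub>R A)"
  shows "ivp_solution A a b (resolvent A)"
proof -
  have "inverse_op (id_blinfun - 0 *\<^sub>R A) = id_blinfun"
    by (rule inverse_op_eq) (simp add: is_inverse_op_iff)
  then have "resolvent A 0 = A"
    by (simp add: resolvent_def blinfun_eq_iff)
  then show ?thesis
    using assms resolvent_has_vector_derivative unfolding ivp_solution_def by blast
qed

section \<open>Every solution is A (Id - tA)^(-1)\<close>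

text \<open>
  Since the derivative \<open>2 f \<bullet> f'\<close> of \<open>\<parallel>f\<parallel>\<^sup>2\<close> is at most \<open>2M \<parallel>f\<parallel>\<^sup>2\<close> in absolute value,
  \<open>exp (-2Mu) \<parallel>f u\<parallel>\<^sup>2\<close> decreases and \<open>exp (2Mu) \<parallel>f u\<parallel>\<^sup>2\<close> increases.  The former forces \<open>f\<close> to
  vanish to the right of a zero, the latter to the left of it.
\<close>

lemma zero_if_derivative_bounded:
  fixes f :: "real \<Rightarrow> 'a::real_inner"
  assumes deriv: "\<And>u. u \<in> closed_segment s t \<Longrightarrow> (f has_vector_derivative f' u) (at u)"
    and bound: "\<And>u. u \<in> closed_segment s t \<Longrightarrow> norm (f' u) \<le> M * norm (f u)"
    and zero: "f s = 0"
  shows "f t = 0"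
proof -
  have sq: "\<bar>2 * (f u \<bullet> f' u)\<bar> \<le> 2 * M * (f u \<bullet> f u)" if "u \<in> closed_segment s t" for u
  proof -
    have "\<bar>f u \<bullet> f' u\<bar> \<le> norm (f u) * norm (f' u)"
      by (rule Cauchy_Schwarz_ineq2)
    also have "\<dots> \<le> norm (f u) * (M * norm (f u))"
      using bound[OF that] by (intro mult_left_mono) auto
    finally show ?thesis
      by (simp add: dot_square_norm power2_eq_square abs_mult mult_ac)
  qed
  have der: "((\<lambda>u. exp (k * u) * (f u \<bullet> f u)) has_real_derivative
      exp (k * u) * (k * (f u \<bullet> f u) + 2 * (f u \<bullet> f' u))) (at u)"
    if "u \<in> closed_segment s t" for k u
  proof -
    have "((\<lambda>u. f u \<bullet> f u) has_vector_derivative (f u \<bullet> f' u + f' u \<bullet> f u)) (at u)"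
      by (rule bounded_bilinear.has_vector_derivative[OF bounded_bilinear_inner])
        (use deriv[OF that] in auto)
    then have "((\<lambda>u. f u \<bullet> f u) has_real_derivative 2 * (f u \<bullet> f' u)) (at u)"
      by (simp add: has_real_derivative_iff_has_vector_derivative inner_commute)
    then show ?thesis
      by (auto intro!: derivative_eq_intros simp: algebra_simps)
  qed
  have "f t \<bullet> f t \<le> 0"
  proof (cases "s \<le> t")
    case True
    have "exp (- 2 * M * t) * (f t \<bullet> f t) \<le> exp (- 2 * M * s) * (f s \<bullet> f s)"
    proof (rule DERIV_nonpos_imp_nonincreasing[OF True])
      fix u assume "s \<le> u" "u \<le> t"
      then have u: "u \<in> closed_segment s t"
        using True by (simp add: closed_segment_eq_real_ivl)
      have "- 2 * M * (f u \<bullet> f u) + 2 * (f u \<bullet> f' u) \<le> 0"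
        using sq[OF u] by linarith
      then show "\<exists>y. ((\<lambda>u. exp (- 2 * M * u) * (f u \<bullet> f u)) has_real_derivative y) (at u) \<and> y \<le> 0"
        using der[OF u] by (meson exp_ge_zero mult_nonneg_nonpos)
    qed
    then show ?thesis
      by (simp add: zero mult_le_0_iff)
  next
    case False
    have "exp (2 * M * t) * (f t \<bullet> f t) \<le> exp (2 * M * s) * (f s \<bullet> f s)"
    proof (rule DERIV_nonneg_imp_nondecreasing[where f = "\<lambda>u. exp (2 * M * u) * (f u \<bullet> f u)"])
      show "t \<le> s"
        using False by simp
    next
      fix u assume "t \<le> u" "u \<le> s"
      then have u: "u \<in> closed_segment s t"
        using False by (simp add: closed_segment_eq_real_ivl)
      have "0 \<le> 2 * M * (f u \<bullet> f u) + 2 * (f u \<bullet> f' u)"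
        using sq[OF u] by linarith
      then show "\<exists>y. ((\<lambda>u. exp (2 * M * u) * (f u \<bullet> f u)) has_real_derivative y) (at u) \<and> 0 \<le> y"
        using der[OF u] by (meson exp_ge_zero mult_nonneg_nonneg)
    qed
    then show ?thesis
      by (simp add: zero mult_le_0_iff)
  qed
  then show ?thesis
    by (metis inner_ge_zero inner_eq_zero_iff order_antisym)
qed

text \<open>
  The difference \<open>p = X (v - u A v) - A v\<close> of both sides at a fixed vector \<open>v\<close> solves \<open>p' = X p\<close>
  and starts at \<open>0\<close>.  Working with vectors makes the inner product available for the growth
  estimate, and \<open>X\<close> is bounded on the compact segment from \<open>0\<close> to \<open>t\<close>.
\<close>

lemma ivp_solution_compose_eq:
  fixes A :: "'a::real_inner \<Rightarrow>\<^sub>L 'a"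
  assumes sol: "ivp_solution A a b X" and t: "t \<in> einterval a b"
  shows "X t o\<^sub>L (id_blinfun - t *\<^sub>R A) = A"
proof (rule blinfun_eqI)
  fix v
  have X0: "X 0 = A"
    using sol unfolding ivp_solution_def by blast
  have seg: "closed_segment 0 t \<subseteq> einterval a b"
  proof
    fix u assume "u \<in> closed_segment 0 t"
    then have "min 0 t \<le> u" "u \<le> max 0 t"
      by (auto simp: closed_segment_eq_real_ivl split: if_splits)
    moreover have "a < ereal (min 0 t)" "ereal (max 0 t) < b"
      using sol t unfolding ivp_solution_def einterval_iff by (auto simp: min_def max_def zero_ereal_def)
    ultimately show "u \<in> einterval a b"
      by (meson einterval_iff ereal_less_eq(3) le_less_trans less_le_trans)
  qed
  have X': "(X has_vector_derivative (X u o\<^sub>L X u)) (at u)" if "u \<in> closed_segment 0 t" for u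
    using sol seg that unfolding ivp_solution_def by blast
  then have "continuous_on (closed_segment 0 t) X"
    by (meson continuous_at_imp_continuous_on has_vector_derivative_continuous)
  then have "bounded (X ` closed_segment 0 t)"
    by (simp add: compact_continuous_image compact_imp_bounded)
  then obtain M where M: "\<And>u. u \<in> closed_segment 0 t \<Longrightarrow> norm (X u) \<le> M"
    unfolding bounded_iff by blast
  define p where "p u = X u (v - u *\<^sub>R A v) - A v" for u
  have "p t = 0"
  proof (rule zero_if_derivative_bounded[where s = 0 and f' = "\<lambda>u. X u (p u)" and M = M])
    fix u assume u: "u \<in> closed_segment 0 t"
    have "((\<lambda>u. v - u *\<^sub>R A v) has_vector_derivative - A v) (at u)"
      by (auto intro!: derivative_eq_intros)
    then have "((\<lambda>u. X u (v - u *\<^sub>R A v)) has_vector_derivative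
        (X u (- A v) + (X u o\<^sub>L X u) (v - u *\<^sub>R A v))) (at u)"
      using X'[OF u] by (intro bounded_bilinear.has_vector_derivative[OF bounded_bilinear_blinfun_apply])
    then have "(p has_vector_derivative
        (X u (- A v) + (X u o\<^sub>L X u) (v - u *\<^sub>R A v))) (at u)"
      unfolding p_def has_vector_derivative_diff_const .
    moreover have "X u (- A v) + (X u o\<^sub>L X u) (v - u *\<^sub>R A v) = X u (p u)"
      by (simp add: p_def blinfun.bilinear_simps)
    ultimately show "(p has_vector_derivative X u (p u)) (at u)"
      by simp
    show "norm (X u (p u)) \<le> M * norm (p u)"
      using M[OF u] by (meson norm_blinfun mult_right_mono norm_ge_zero order_trans)
  qed (simp add: p_def X0)
  then show "(X t o\<^sub>L (id_blinfun - t *\<^sub>R A)) v = A v"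
    by (simp add: p_def blinfun.bilinear_simps)
qed

text \<open>
  By \<open>X (Id - tA) = A\<close>, the kernel of \<open>Id - tA\<close> lies in the kernel of \<open>A\<close>, where \<open>Id - tA\<close> acts
  as the identity; so it is trivial.
\<close>

lemma ivp_solution_eq_resolvent:
  fixes A :: "'a::real_inner \<Rightarrow>\<^sub>L 'a"
  assumes "finite_dimensional TYPE('a)" and sol: "ivp_solution A a b X" and t: "t \<in> einterval a b"
  shows "invertible_op (id_blinfun - t *\<^sub>R A) \<and> X t = resolvent A t"
proof
  let ?C = "id_blinfun - t *\<^sub>R A"
  have XC: "X t (?C v) = A v" for v
    using ivp_solution_compose_eq[OF sol t] by (metis blinfun_apply_blinfun_compose)
  show inv: "invertible_op ?C"
  proof (rule invertible_op_if_injective[OF assms(1)])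
    fix v assume v: "?C v = 0"
    then have "A v = 0"
      using XC[of v] by (simp add: blinfun.bilinear_simps)
    with v show "v = 0"
      by (simp add: blinfun.bilinear_simps)
  qed
  show "X t = resolvent A t"
  proof (rule blinfun_eqI)
    fix v
    have "?C (inverse_op ?C v) = v"
      using is_inverse_op_inverse_op[OF inv] by (simp add: is_inverse_op_iff)
    then show "X t v = resolvent A t v"
      using XC[of "inverse_op ?C v"] by (simp add: resolvent_def)
  qed
qed

section \<open>The maximal interval of existence\<close>

text \<open>
  The interval runs from the last singular time before \<open>0\<close> to the first one after \<open>0\<close>; for an
  empty set of singular times, the conventions \<open>Sup {} = -\<infinity>\<close> and \<open>Inf {} = \<infinity>\<close> give the right ends.
\<close>

lemma ex_maximal_ivp_solution:
  fixes A :: "'a::real_inner \<Rightarrow>\<^sub>L 'a"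
  assumes fin: "finite_dimensional TYPE('a)"
  shows "\<exists>a b X. maximal_ivp_solution A a b X"
proof -
  define S where "S = {t. \<not> invertible_op (id_blinfun - t *\<^sub>R A)}"
  define a where "a = Sup (ereal ` {t \<in> S. t < 0})"
  define b where "b = Inf (ereal ` {t \<in> S. 0 < t})"
  have "is_inverse_op (id_blinfun - 0 *\<^sub>R A) id_blinfun"
    by (simp add: is_inverse_op_iff)
  then have "0 \<notin> S"
    unfolding S_def invertible_op_def by blast
  moreover have "open (- S)"
    using open_regular_times[OF fin, of A] by (simp add: S_def Compl_eq)
  ultimately obtain e where e: "0 < e" "ball 0 e \<subseteq> - S"
    by (metis ComplI open_contains_ball)
  have far: "e \<le> \<bar>t\<bar>" if "t \<in> S" for t
    using e(2) that by (force simp: dist_real_def)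
  have "a \<le> ereal (- e)"
    unfolding a_def by (rule Sup_least) (use far in fastforce)
  also have "\<dots> < 0"
    using e(1) by simp
  finally have a: "a < 0" .
  have "0 < ereal e"
    using e(1) by simp
  also have "\<dots> \<le> b"
    unfolding b_def by (rule Inf_greatest) (use far in fastforce)
  finally have b: "0 < b" .
  have "t \<notin> S" if "t \<in> einterval a b" for t
  proof
    assume "t \<in> S"
    with \<open>0 \<notin> S\<close> consider "t < 0" | "0 < t"
      by (metis linorder_neqE_linordered_idom)
    then show False
    proof cases
      case 1
      with \<open>t \<in> S\<close> have "ereal t \<le> a"
        unfolding a_def by (intro Sup_upper) blast
      with that show False
        by (meson einterval_iff leD)
    next
      case 2
      with \<open>t \<in> S\<close> have "b \<le> ereal t"
        unfolding b_def by (intro Inf_lower) blast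
      with that show False
        by (meson einterval_iff leD)
    qed
  qed
  then have sol: "ivp_solution A a b (resolvent A)"
    using resolvent_ivp_solution[OF fin a b] by (simp add: S_def)
  have "a' = a \<and> b' = b" if Y: "ivp_solution A a' b' Y" and le: "a' \<le> a" "b \<le> b'" for a' b' Y
  proof -
    have avoid: "t \<notin> S" if "a' < ereal t" "ereal t < b'" for t
      using ivp_solution_eq_resolvent[OF fin Y] that by (simp add: S_def einterval_iff)
    have "\<not> a' < a"
    proof
      assume "a' < a"
      then obtain t where "t \<in> S" "t < 0" "a' < ereal t"
        unfolding a_def less_Sup_iff by blast
      moreover have "ereal t < b'"
        using less_trans[of "ereal t" 0 b] \<open>t < 0\<close> b le(2) by simp
      ultimately show False
        using avoid by blast
    qed
    moreover have "\<not> b < b'"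
    proof
      assume "b < b'"
      then obtain t where "t \<in> S" "0 < t" "ereal t < b'"
        unfolding b_def Inf_less_iff by blast
      moreover have "a' < ereal t"
        using less_trans[of a 0 "ereal t"] \<open>0 < t\<close> a le(1) by simp
      ultimately show False
        using avoid by blast
    qed
    ultimately show ?thesis
      using le by simp
  qed
  then have "maximal_ivp_solution A a b (resolvent A)"
    using sol unfolding maximal_ivp_solution_def by blast
  then show ?thesis
    by blast
qed

lemma blows_up_iff_singular_time:
  fixes A :: "'a::real_inner \<Rightarrow>\<^sub>L 'a"
  assumes fin: "finite_dimensional TYPE('a)" and max: "maximal_ivp_solution A a b X"
  shows "blows_up_at_finite_time a b \<longleftrightarrow> (\<exists>t. \<not> invertible_op (id_blinfun - t *\<^sub>R A))"
proof
  have sol: "ivp_solution A a b X"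
    using max unfolding maximal_ivp_solution_def by blast
  note eq = ivp_solution_eq_resolvent[OF fin sol]
  show "blows_up_at_finite_time a b" if singular: "\<exists>t. \<not> invertible_op (id_blinfun - t *\<^sub>R A)"
  proof -
    obtain t where "t \<notin> einterval a b"
      using singular eq by blast
    then show ?thesis
      by (auto simp: blows_up_at_finite_time_def einterval_iff)
  qed
  show "\<exists>t. \<not> invertible_op (id_blinfun - t *\<^sub>R A)" if "blows_up_at_finite_time a b"
  proof (rule ccontr)
    assume "\<not> (\<exists>t. \<not> invertible_op (id_blinfun - t *\<^sub>R A))"
    then have "ivp_solution A (-\<infinity>) \<infinity> (resolvent A)"
      by (intro resolvent_ivp_solution[OF fin]) auto
    moreover have "\<forall>t\<in>einterval a b. resolvent A t = X t"
      using eq by simp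
    ultimately have "-\<infinity> = a \<and> \<infinity> = b"
      using max unfolding maximal_ivp_solution_def by (meson ereal_less_eq(1,2))
    with that show False
      by (auto simp: blows_up_at_finite_time_def)
  qed
qed

theorem corollary1p2:
  fixes A :: "'a::real_inner \<Rightarrow>\<^sub>L 'a"
  assumes "finite_dimensional TYPE('a)"
    and "symmetric_op A"
  shows "(\<exists>Tm Tp X. maximal_ivp_solution A Tm Tp X) \<and>
    (\<forall>Tm Tp X. maximal_ivp_solution A Tm Tp X \<longrightarrow>
       (\<forall>t\<in>einterval Tm Tp.
          invertible_op (id_blinfun - t *\<^sub>R A) \<and>
          X t = A o\<^sub>L inverse_op (id_blinfun - t *\<^sub>R A)) \<and>
       (blows_up_at_finite_time Tm Tp \<longleftrightarrow> (\<exists>l\<in>spectrum_op A. l \<noteq> 0)))"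
proof (intro conjI allI impI)
  show "\<exists>Tm Tp X. maximal_ivp_solution A Tm Tp X"
    using assms(1) by (rule ex_maximal_ivp_solution)
next
  fix Tm Tp X
  assume max: "maximal_ivp_solution A Tm Tp X"
  then have "ivp_solution A Tm Tp X"
    unfolding maximal_ivp_solution_def by blast
  from ivp_solution_eq_resolvent[OF assms(1) this]
  show "\<forall>t\<in>einterval Tm Tp. invertible_op (id_blinfun - t *\<^sub>R A) \<and>
      X t = A o\<^sub>L inverse_op (id_blinfun - t *\<^sub>R A)"
    by (simp add: resolvent_def)
  show "blows_up_at_finite_time Tm Tp \<longleftrightarrow> (\<exists>l\<in>spectrum_op A. l \<noteq> 0)"
    using blows_up_iff_singular_time[OF assms(1) max] ex_nonzero_spectrum_iff by blast
qed

end
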